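(* Let $H\in\mathbb{R}^{n\times n}$ be symmetric and let $c\in\mathbb{R}^n$, $c\neq 0$. Let $\theta_0,\dots,\theta_{r-1}$ be arbitrary nonzero real numbers and let $(q_k,y_k,\delta_k)$, $k=0,\dots,r$, be the unnormalized Lanczos triples generated from $H$, $c$ and the $\theta_k$ (defined in the context). Then, for $k=0,\dots,r$, it holds that $x_k^{MR}$ solves $\min_{x\in\mathcal{K}_k(c,H)}\|Hx+c\|_2^2$ if and only if $x_k^{MR}=\sum_{i=0}^k\gamma_iy_i$ for some $\gamma_i$, $i=0,\dots,k$, that are optimal to $$\min_{\gamma_0,\dots,\gamma_k}\ \tfrac12\sum_{i=0}^k\gamma_i^2q_i^Tq_i\quad\text{subject to}\quad\sum_{i=0}^k\gamma_i\delta_i=1.$$ In particular, $x_k^{MR}$ takes the following form for the mutually exclusive cases (a) $k<r$; (b) $k=r$ and $\delta_r\neq 0$; and (c) $k=r$ and $\delta_r=0$. (a) For $k<r$, it holds that $$x_k^{MR}=\frac{1}{\sum_{j=0}^k\frac{\delta_j^2}{q_j^Tq_j}}\sum_{i=0}^k\frac{\delta_i}{q_i^Tq_i}y_i,$$ and $g_k^{MR}=Hx_k^{MR}+c\neq 0$. (b) For $k=r$ and $\delta_r\neq 0$, it holds that $x_r^{MR}=(1/\delta_r)y_r$ and $g_r^{MR}=Hx_r^{MR}+c=0$, so that $x_r^{MR}$ solves $Hx+c=0$. (c) For $k=r$ and $\delta_r=0$, it holds that $x_r^{MR}=x_{r-1}^{MR}+\gamma_ry_r$, where $\gamma_r$ is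 an arbitrary scalar, and $g_r^{MR}=Hx_r^{MR}+c=g_{r-1}^{MR}\neq 0$. In addition, $x_{r-1}^{MR}$ and $x_r^{MR}$ solve $\min_{x\in\mathbb{R}^n}\|Hx+c\|_2^2$. The particular choice $$\gamma_r=-\frac{y_r^Tx_{r-1}^{MR}}{y_r^Ty_r}$$ makes $x_r^{MR}$ an optimal solution to $\min_{x\in\mathbb{R}^n}\|Hx+c\|_2^2$ of minimum Euclidean norm.
   Context: For $k=0,\dots,r$, $x_k^{MR}$ denotes a solution to $\min_{x\in\mathcal{K}_k(c,H)}\|Hx+c\|_2^2$, and $g_k^{MR}=Hx_k^{MR}+c$ is the corresponding residual. All arithmetic is exact and norms are Euclidean. Krylov subspaces: $\mathcal{K}_0(c,H)=\{0\}$ and $\mathcal{K}_k(c,H)=\mathrm{span}\{c,Hc,\dots,H^{k-1}c\}$ for $k\geq 1$. $r$ denotes the smallest positive integer $k$ for which $\mathcal{K}_{k+1}(c,H)=\mathcal{K}_k(c,H)$. Unnormalized Lanczos triples: given nonzero reals $\theta_0,\dots,\theta_{r-1}$, set $(q_0,y_0,\delta_0)=(c,0,1)$, $$q_1=\theta_0(-Hq_0+\alpha_0q_0),\quad y_1=\theta_0(-q_0+\alpha_0y_0),\quad \delta_1=\theta_0\alpha_0\delta_0,$$ and for $k=1,\dots,r-1$, $$q_{k+1}=\theta_k(-Hq_k+\alpha_kq_k+\beta_{k-1}q_{k-1}),\quad y_{k+1}=\theta_k(-q_k+\alpha_ky_k+\beta_{k-1}y_{k-1}),\quad \delta_{k+1}=\theta_k(\alpha_k\delta_k+\beta_{k-1}\delta_{k-1}),$$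 where $\alpha_k=\frac{q_k^THq_k}{q_k^Tq_k}$ for $k=0,\dots,r-1$ and $\beta_{k-1}=\frac{q_{k-1}^THq_k}{q_{k-1}^Tq_{k-1}}$ for $k=1,\dots,r-1$. These are well defined, with $q_k\in\mathcal{K}_{k+1}(c,H)\cap\mathcal{K}_k(c,H)^\perp$, $y_k\in\mathcal{K}_k(c,H)$ and $q_k=Hy_k+\delta_kc$; moreover $q_k\neq 0$ for $k<r$, $q_r=0$, and $y_1,\dots,y_r$ are linearly independent. *)

theory Defs
  imports "HOL-Analysis.Analysis"
begin

text \<open>For \<open>k = 0\<close> the spanning set is empty, so the space is \<open>{0}\<close>.\<close>

definition krylov :: "real^'n \<Rightarrow> real^'n^'n \<Rightarrow> nat \<Rightarrow> (real^'n) set" where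
  "krylov c H k = span ((\<lambda>i. (((*v) H) ^^ i) c) ` {..<k})"

definition krylov_grade :: "real^'n \<Rightarrow> real^'n^'n \<Rightarrow> nat" where
  "krylov_grade c H = (LEAST k. 0 < k \<and> krylov c H (k + 1) = krylov c H k)"

text \<open>\<open>lanczos_coeff H u v\<close> is the common shape of
  \<open>\<alpha>\<^sub>k = lanczos_coeff H q\<^sub>k q\<^sub>k\<close> and
  \<open>\<beta>\<^sub>k = lanczos_coeff H q\<^sub>k q\<^sub>k\<^sub>+\<^sub>1\<close>.\<close>

definition lanczos_coeff :: "real^'n^'n \<Rightarrow> real^'n \<Rightarrow> real^'n \<Rightarrow> real" where
  "lanczos_coeff H u v = (u \<bullet> (H *v v)) / (u \<bullet> u)"

text \<open>The recursions below are total in \<open>k\<close>; only the indices up to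
  \<open>krylov_grade c H\<close> are meaningful, since from there on \<open>q\<close> vanishes and the
  coefficients become divisions by zero.\<close>

fun lanczos_q :: "real^'n^'n \<Rightarrow> real^'n \<Rightarrow> (nat \<Rightarrow> real) \<Rightarrow> nat \<Rightarrow> real^'n" where
  "lanczos_q H c \<theta> 0 = c"
| "lanczos_q H c \<theta> (Suc 0) = \<theta> 0 *\<^sub>R (- (H *v c) + lanczos_coeff H c c *\<^sub>R c)"
| "lanczos_q H c \<theta> (Suc (Suc k)) =
     (let q = lanczos_q H c \<theta> (Suc k); q' = lanczos_q H c \<theta> k
      in \<theta> (Suc k) *\<^sub>R (- (H *v q) + lanczos_coeff H q q *\<^sub>R q + lanczos_coeff H q' q *\<^sub>R q'))"

definition lanczos_alpha :: "real^'n^'n \<Rightarrow> real^'n \<Rightarrow> (nat \<Rightarrow> real) \<Rightarrow> nat \<Rightarrow> real" where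
  "lanczos_alpha H c \<theta> k = lanczos_coeff H (lanczos_q H c \<theta> k) (lanczos_q H c \<theta> k)"

definition lanczos_beta :: "real^'n^'n \<Rightarrow> real^'n \<Rightarrow> (nat \<Rightarrow> real) \<Rightarrow> nat \<Rightarrow> real" where
  "lanczos_beta H c \<theta> k = lanczos_coeff H (lanczos_q H c \<theta> k) (lanczos_q H c \<theta> (Suc k))"

fun lanczos_y :: "real^'n^'n \<Rightarrow> real^'n \<Rightarrow> (nat \<Rightarrow> real) \<Rightarrow> nat \<Rightarrow> real^'n" where
  "lanczos_y H c \<theta> 0 = 0"
| "lanczos_y H c \<theta> (Suc 0) =
     \<theta> 0 *\<^sub>R (- lanczos_q H c \<theta> 0 + lanczos_alpha H c \<theta> 0 *\<^sub>R lanczos_y H c \<theta> 0)"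
| "lanczos_y H c \<theta> (Suc (Suc k)) =
     \<theta> (Suc k) *\<^sub>R (- lanczos_q H c \<theta> (Suc k)
       + lanczos_alpha H c \<theta> (Suc k) *\<^sub>R lanczos_y H c \<theta> (Suc k)
       + lanczos_beta H c \<theta> k *\<^sub>R lanczos_y H c \<theta> k)"

fun lanczos_delta :: "real^'n^'n \<Rightarrow> real^'n \<Rightarrow> (nat \<Rightarrow> real) \<Rightarrow> nat \<Rightarrow> real" where
  "lanczos_delta H c \<theta> 0 = 1"
| "lanczos_delta H c \<theta> (Suc 0) = \<theta> 0 * (lanczos_alpha H c \<theta> 0 * lanczos_delta H c \<theta> 0)"
| "lanczos_delta H c \<theta> (Suc (Suc k)) =
     \<theta> (Suc k) * (lanczos_alpha H c \<theta> (Suc k) * lanczos_delta H c \<theta> (Suc k)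
       + lanczos_beta H c \<theta> k * lanczos_delta H c \<theta> k)"

definition MR_solution :: "real^'n^'n \<Rightarrow> real^'n \<Rightarrow> nat \<Rightarrow> real^'n \<Rightarrow> bool" where
  "MR_solution H c k x \<longleftrightarrow>
     is_arg_min (\<lambda>z. (norm (H *v z + c))\<^sup>2) (\<lambda>z. z \<in> krylov c H k) x"

definition LS_solution :: "real^'n^'n \<Rightarrow> real^'n \<Rightarrow> real^'n \<Rightarrow> bool" where
  "LS_solution H c x \<longleftrightarrow> is_arg_min (\<lambda>z. (norm (H *v z + c))\<^sup>2) (\<lambda>z. True) x"

text \<open>Only the values \<open>\<gamma> 0, \<dots>, \<gamma> k\<close> enter the objective and the constraint; the
  remaining values of the function \<open>\<gamma>\<close> are irrelevant.\<close>

definition optimal_weights ::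
    "(nat \<Rightarrow> real^'n) \<Rightarrow> (nat \<Rightarrow> real) \<Rightarrow> nat \<Rightarrow> (nat \<Rightarrow> real) \<Rightarrow> bool" where
  "optimal_weights q \<delta> k \<gamma> \<longleftrightarrow>
     is_arg_min (\<lambda>\<gamma>. 1/2 * (\<Sum>i\<le>k. (\<gamma> i)\<^sup>2 * (q i \<bullet> q i))) (\<lambda>\<gamma>. (\<Sum>i\<le>k. \<gamma> i * \<delta> i) = 1) \<gamma>"

end

theory Submission
  imports Defs
begin

text \<open>For \<open>k \<le> r\<close>, where \<open>r\<close> is the grade, the vectors \<open>q 0, \<dots>, q (k - 1)\<close> form an orthogonal basis
  of the \<open>k\<close>-th Krylov space.  As \<open>q i = H *v y i + \<delta> i *\<^sub>R c\<close> (lemma \<open>q_eq\<close>), a combination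
  \<open>\<Sum>i\<le>k. \<gamma> i *\<^sub>R y i\<close> with \<open>(\<Sum>i\<le>k. \<gamma> i * \<delta> i) = 1\<close> has the residual
  \<open>\<Sum>i\<le>k. \<gamma> i *\<^sub>R q i\<close>, whose squared norm is \<open>\<Sum>i\<le>k. (\<gamma> i)\<^sup>2 * (q i \<bullet> q i)\<close> by
  orthogonality.  Every point of the \<open>k\<close>-th Krylov space is such a combination, because
  \<open>y 0, \<dots>, y k\<close> span it and \<open>y 0 = 0\<close> leaves the weight at \<open>0\<close> free to satisfy the constraint.
  So minimizing the residual over the Krylov space is the same problem as minimizing a separable
  quadratic under one linear constraint (lemma \<open>MR_solution_iff_weights\<close>).

  Below the grade all \<open>q i\<close> are nonzero, the quadratic is strictly convex, and completing the
  square gives its unique minimizer and its positive minimum.  At the grade \<open>q r = 0\<close>, so the last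
  weight is free of charge.  If \<open>\<delta> r \<noteq> 0\<close>, it can satisfy the constraint alone, and the residual
  vanishes.  If \<open>\<delta> r = 0\<close>, it takes no part in the constraint either, so the minimizers are those
  of the previous step translated along \<open>y r\<close>, and \<open>H *v y r = 0\<close>.

  The \<open>r\<close>-th Krylov space is invariant under the symmetric matrix \<open>H\<close> and contains \<open>c\<close>, so its
  orthogonal complement is invariant too and adds an orthogonal term to the residual: minimizers over
  the space are global minimizers (lemma \<open>MR_solution_imp_LS_solution\<close>).  Global minimizers differ
  by kernel vectors, so the one of least norm is the one orthogonal to the kernel.  For a point
  of the Krylov space it is enough to be orthogonal to \<open>y r\<close>, since the projection of the
  kernel to that space is the line through \<open>y r\<close> (lemma \<open>krylov_orthogonal_kernel\<close>).\<close>

section \<open>Spans, minimizers and Krylov spaces\<close>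

lemma linear_maps_span_into:
  assumes "linear f" and "\<And>x. x \<in> S \<Longrightarrow> f x \<in> span T" and "x \<in> span S"
  shows "f x \<in> span T"
proof -
  have "f ` span S = span (f ` S)"
    using linear_span_image[OF assms(1)] by simp
  also have "\<dots> \<subseteq> span T"
    using assms(2) by (intro span_minimal) auto
  finally show ?thesis
    using assms(3) by blast
qed

lemma span_image_atMost_sum:
  fixes v :: "nat \<Rightarrow> 'a::real_vector"
  assumes "x \<in> span (v ` {..k})"
  shows "\<exists>\<gamma>. x = (\<Sum>i\<le>k. \<gamma> i *\<^sub>R v i)"
  using assms
proof (induction k arbitrary: x)
  case 0
  then have "x \<in> span {v 0}" by simp
  then obtain a where "x = a *\<^sub>R v 0"
    by (auto simp: span_singleton)
  then show ?case by (intro exI[of _ "\<lambda>_. a"]) simp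
next
  case (Suc k)
  then obtain a where "x - a *\<^sub>R v (Suc k) \<in> span (v ` {..k})"
    by (auto simp: atMost_Suc span_breakdown_eq)
  then obtain \<gamma> where \<gamma>: "x - a *\<^sub>R v (Suc k) = (\<Sum>i\<le>k. \<gamma> i *\<^sub>R v i)"
    using Suc.IH by blast
  have "(\<Sum>i\<le>Suc k. (\<gamma>(Suc k := a)) i *\<^sub>R v i) = (\<Sum>i\<le>k. \<gamma> i *\<^sub>R v i) + a *\<^sub>R v (Suc k)"
    by simp
  also have "\<dots> = x"
    by (simp flip: \<gamma>)
  finally show ?case by metis
qed

text \<open>Distinct parameters of the same point have the same objective value, so minimizers correspond
  to minimizers even when \<open>F\<close> identifies parameters.\<close>

lemma is_arg_min_reparametrize:
  fixes f :: "'a \<Rightarrow> real" and g :: "'b \<Rightarrow> real"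
  assumes onto: "\<And>x. Q x \<Longrightarrow> \<exists>w. P w \<and> x = F w"
    and into: "\<And>w. P w \<Longrightarrow> Q (F w)"
    and obj: "\<And>w. P w \<Longrightarrow> f (F w) = a * g w" and "a > 0"
  shows "is_arg_min f Q x \<longleftrightarrow> (\<exists>w. is_arg_min g P w \<and> x = F w)"
proof
  assume x: "is_arg_min f Q x"
  then obtain w where w: "P w" "x = F w"
    using onto unfolding is_arg_min_def by blast
  have "\<not> g w' < g w" if "P w'" for w'
  proof
    assume "g w' < g w"
    then have "f (F w') < f x"
      using obj w that \<open>a > 0\<close> by simp
    then show False
      using x into[OF that] unfolding is_arg_min_def by blast
  qed
  then show "\<exists>w. is_arg_min g P w \<and> x = F w"
    using w unfolding is_arg_min_def by blast
next
  assume "\<exists>w. is_arg_min g P w \<and> x = F w"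
  then obtain w where w: "P w" "\<And>w'. P w' \<Longrightarrow> \<not> g w' < g w" "x = F w"
    unfolding is_arg_min_def by blast
  have "\<not> f x' < f x" if x': "Q x'" for x'
  proof -
    obtain w' where "P w'" "x' = F w'"
      using onto[OF x'] by blast
    then show ?thesis
      using w obj \<open>a > 0\<close> by simp
  qed
  then show "is_arg_min f Q x"
    using w into unfolding is_arg_min_def by blast
qed

text \<open>Two minimizers have the same residual, for otherwise their midpoint would do better.\<close>

lemma LS_solution_diff_kernel:
  assumes "LS_solution H c x" and "LS_solution H c z"
  shows "H *v (x - z) = 0"
proof -
  define a where "a = H *v x + c"
  define b where "b = H *v z + c"
  let ?m = "(1/2) *\<^sub>R (x + z)"
  have "a + b = H *v (x + z) + (c + c)"
    by (simp add: a_def b_def matrix_vector_right_distrib)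
  then have m: "H *v ?m + c = (1/2) *\<^sub>R (a + b)"
    by (simp only: matrix_vector_mult_scaleR scaleR_half_double scaleR_add_right[of _ _ "c + c"])
  have "(norm a)\<^sup>2 \<le> (norm ((1/2) *\<^sub>R (a + b)))\<^sup>2" "(norm b)\<^sup>2 \<le> (norm ((1/2) *\<^sub>R (a + b)))\<^sup>2"
    using assms unfolding LS_solution_def is_arg_min_linorder a_def[symmetric] b_def[symmetric]
    by (metis m)+
  then have "a \<bullet> a \<le> (a \<bullet> a + 2 * (a \<bullet> b) + b \<bullet> b) / 4" "b \<bullet> b \<le> (a \<bullet> a + 2 * (a \<bullet> b) + b \<bullet> b) / 4"
    unfolding power2_norm_eq_inner
    by (simp_all add: inner_add_left inner_add_right inner_commute)
  then have "(a - b) \<bullet> (a - b) \<le> 0"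
    by (simp add: inner_diff_left inner_diff_right inner_commute)
  then have "(a - b) \<bullet> (a - b) = 0"
    using inner_ge_zero[of "a - b"] by linarith
  then have "a = b" by simp
  then show ?thesis
    by (simp add: a_def b_def matrix_vector_mult_diff_distrib)
qed

lemma subspace_krylov: "subspace (krylov c H k)"
  by (simp add: krylov_def)

lemma krylov_mono: "i \<le> j \<Longrightarrow> krylov c H i \<subseteq> krylov c H j"
  unfolding krylov_def by (intro span_mono image_mono) auto

lemma krylov_start: "c \<in> krylov c H (Suc k)"
  unfolding krylov_def by (rule span_base) (force intro: image_eqI[of _ _ 0])

lemma krylov_mult:
  assumes "x \<in> krylov c H k"
  shows "H *v x \<in> krylov c H (Suc k)"
  using assms unfolding krylov_def
proof (rule linear_maps_span_into[rotated 2])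
  show "linear ((*v) H)" by simp
next
  fix z assume "z \<in> (\<lambda>i. (((*v) H) ^^ i) c) ` {..<k}"
  then obtain i where "i < k" "z = (((*v) H) ^^ i) c" by blast
  then have "H *v z = (((*v) H) ^^ Suc i) c" "Suc i < Suc k" by auto
  then show "H *v z \<in> span ((\<lambda>i. (((*v) H) ^^ i) c) ` {..<Suc k})"
    by (metis imageI lessThan_iff span_base)
qed

text \<open>As long as the spaces grow their dimension grows, and it is bounded by the dimension of the
  ambient space.\<close>

lemma krylov_stabilizes: "\<exists>k>0. krylov c H (k + 1) = krylov c H k"
proof (rule ccontr)
  assume "\<not> ?thesis"
  then have neq: "krylov c H (Suc k) \<noteq> krylov c H k" if "k > 0" for k
    using that by (metis Suc_eq_plus1)
  have "dim (krylov c H (Suc k)) \<ge> k" for k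
  proof (induction k)
    case (Suc k)
    have "krylov c H (Suc k) \<subset> krylov c H (Suc (Suc k))"
      using neq[of "Suc k"] krylov_mono[of "Suc k" "Suc (Suc k)" c H] by auto
    then have "dim (krylov c H (Suc k)) < dim (krylov c H (Suc (Suc k)))"
      by (intro dim_psubset) (simp only: span_eq_iff[THEN iffD2, OF subspace_krylov])
    then show ?case using Suc by simp
  qed simp
  from this[of "Suc (CARD('a))"] show False
    using dim_subset_UNIV_cart[of "krylov c H (Suc (Suc (CARD('a))))"] by simp
qed

lemma
  shows krylov_grade_pos: "krylov_grade c H > 0"
    and krylov_grade_stable: "krylov c H (Suc (krylov_grade c H)) = krylov c H (krylov_grade c H)"
  using LeastI_ex[OF krylov_stabilizes, of c H] unfolding krylov_grade_def by auto

lemma krylov_below_grade: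
  assumes "c \<noteq> 0" and "k < krylov_grade c H"
  shows "krylov c H (Suc k) \<noteq> krylov c H k"
proof (cases "k = 0")
  case True
  then show ?thesis
    using assms(1) krylov_start[of c H 0] by (auto simp: krylov_def)
next
  case False
  then show ?thesis
    using not_less_Least[of k "\<lambda>k. 0 < k \<and> krylov c H (k + 1) = krylov c H k"] assms(2)
    unfolding krylov_grade_def by auto
qed

section \<open>The constrained weight problem\<close>

lemma optimal_weights_cong:
  assumes "\<And>i. i \<le> k \<Longrightarrow> \<gamma> i = \<gamma>' i"
  shows "optimal_weights q \<delta> k \<gamma> \<longleftrightarrow> optimal_weights q \<delta> k \<gamma>'"
proof -
  have "(\<Sum>i\<le>k. (\<gamma> i)\<^sup>2 * (q i \<bullet> q i)) = (\<Sum>i\<le>k. (\<gamma>' i)\<^sup>2 * (q i \<bullet> q i))"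
    "(\<Sum>i\<le>k. \<gamma> i * \<delta> i) = (\<Sum>i\<le>k. \<gamma>' i * \<delta> i)"
    using assms by (auto intro!: sum.cong)
  then show ?thesis
    unfolding optimal_weights_def is_arg_min_def by simp
qed

text \<open>A weight with \<open>q = 0\<close> and \<open>\<delta> = 0\<close> costs nothing and contributes nothing to the
  constraint.  This is where the free scalar in the singular case comes from.\<close>

lemma optimal_weights_free_last:
  assumes "q (Suc m) = 0" and "\<delta> (Suc m) = 0"
  shows "optimal_weights q \<delta> (Suc m) \<gamma> \<longleftrightarrow> optimal_weights q \<delta> m \<gamma>"
  using assms unfolding optimal_weights_def is_arg_min_def by simp

text \<open>The quantities \<open>\<gamma> i = \<delta> i / (S * (q i \<bullet> q i))\<close> are the stationary point of the Lagrangian.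
  On the constraint set the objective exceeds its value there by half the squared distance to
  that point, weighted with \<open>q i \<bullet> q i\<close>, so it is the only minimizer.\<close>

lemma
  fixes q :: "nat \<Rightarrow> real^'n" and \<delta> :: "nat \<Rightarrow> real" and k :: nat
  defines "S \<equiv> \<Sum>j\<le>k. (\<delta> j)\<^sup>2 / (q j \<bullet> q j)"
  assumes q: "\<And>i. i \<le> k \<Longrightarrow> q i \<noteq> 0" and S: "S > 0"
  shows optimal_weights_iff:
      "optimal_weights q \<delta> k \<gamma> \<longleftrightarrow> (\<forall>i\<le>k. \<gamma> i = 1 / S * (\<delta> i / (q i \<bullet> q i)))"
    and optimal_weights_value:
      "optimal_weights q \<delta> k \<gamma> \<Longrightarrow> (\<Sum>i\<le>k. (\<gamma> i)\<^sup>2 * (q i \<bullet> q i)) = 1 / S"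
proof -
  define w where "w i = 1 / S * (\<delta> i / (q i \<bullet> q i))" for i
  define obj where "obj \<gamma> = (\<Sum>i\<le>k. (\<gamma> i)\<^sup>2 * (q i \<bullet> q i))" for \<gamma>
  have wd: "(\<Sum>i\<le>k. w i * \<delta> i) = 1"
  proof -
    have "(\<Sum>i\<le>k. w i * \<delta> i) = (\<Sum>i\<le>k. 1 / S * ((\<delta> i)\<^sup>2 / (q i \<bullet> q i)))"
      by (intro sum.cong) (auto simp: w_def power2_eq_square)
    also have "\<dots> = 1 / S * S"
      by (simp only: sum_distrib_left[symmetric]) (simp add: S_def)
    finally show ?thesis using S by simp
  qed
  have square: "obj \<gamma> = 1 / S + (\<Sum>i\<le>k. (\<gamma> i - w i)\<^sup>2 * (q i \<bullet> q i))"
    if "(\<Sum>i\<le>k. \<gamma> i * \<delta> i) = 1" for \<gamma>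
  proof -
    have "(\<gamma> i - w i)\<^sup>2 * (q i \<bullet> q i)
        = (\<gamma> i)\<^sup>2 * (q i \<bullet> q i) - 2 / S * (\<gamma> i * \<delta> i) + 1 / S * (w i * \<delta> i)" if "i \<le> k" for i
    proof -
      have "w i * (q i \<bullet> q i) = 1 / S * \<delta> i"
        using q[OF that] by (simp add: w_def)
      moreover have "(\<gamma> i - w i)\<^sup>2 * (q i \<bullet> q i)
          = (\<gamma> i)\<^sup>2 * (q i \<bullet> q i) - 2 * \<gamma> i * (w i * (q i \<bullet> q i)) + w i * (w i * (q i \<bullet> q i))"
        by (simp add: power2_eq_square algebra_simps)
      ultimately show ?thesis by simp
    qed
    then have "(\<Sum>i\<le>k. (\<gamma> i - w i)\<^sup>2 * (q i \<bullet> q i))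
        = (\<Sum>i\<le>k. (\<gamma> i)\<^sup>2 * (q i \<bullet> q i) - 2 / S * (\<gamma> i * \<delta> i) + 1 / S * (w i * \<delta> i))"
      by (intro sum.cong) auto
    also have "\<dots> = obj \<gamma> - 2 / S * (\<Sum>i\<le>k. \<gamma> i * \<delta> i) + 1 / S * (\<Sum>i\<le>k. w i * \<delta> i)"
      by (simp only: sum.distrib sum_subtractf sum_distrib_left obj_def)
    finally show ?thesis using that wd by simp
  qed
  have excess_nonneg: "(\<Sum>i\<le>k. (\<gamma> i - w i)\<^sup>2 * (q i \<bullet> q i)) \<ge> 0" for \<gamma>
    by (intro sum_nonneg) simp
  have excess_0: "(\<Sum>i\<le>k. (\<gamma> i - w i)\<^sup>2 * (q i \<bullet> q i)) = 0 \<longleftrightarrow> (\<forall>i\<le>k. \<gamma> i = w i)" for \<gamma>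
    using q by (subst sum_nonneg_eq_0_iff) auto
  have obj_w: "obj w = 1 / S"
    using square[OF wd] by simp
  have opt: "optimal_weights q \<delta> k \<gamma> \<longleftrightarrow>
      (\<Sum>i\<le>k. \<gamma> i * \<delta> i) = 1 \<and> (\<forall>\<gamma>'. (\<Sum>i\<le>k. \<gamma>' i * \<delta> i) = 1 \<longrightarrow> obj \<gamma> \<le> obj \<gamma>')" for \<gamma>
    unfolding optimal_weights_def is_arg_min_def obj_def by (auto simp: not_less)
  have val: "obj \<gamma> = 1 / S" if "optimal_weights q \<delta> k \<gamma>" for \<gamma>
  proof -
    have "obj \<gamma> \<le> obj w" "(\<Sum>i\<le>k. \<gamma> i * \<delta> i) = 1"
      using that wd unfolding opt by auto
    then show ?thesis
      using square[of \<gamma>] excess_nonneg[of \<gamma>] obj_w by linarith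
  qed
  show "optimal_weights q \<delta> k \<gamma> \<Longrightarrow> (\<Sum>i\<le>k. (\<gamma> i)\<^sup>2 * (q i \<bullet> q i)) = 1 / S"
    using val by (simp add: obj_def)
  show "optimal_weights q \<delta> k \<gamma> \<longleftrightarrow> (\<forall>i\<le>k. \<gamma> i = 1 / S * (\<delta> i / (q i \<bullet> q i)))"
    (is "_ \<longleftrightarrow> ?R")
  proof
    assume o: "optimal_weights q \<delta> k \<gamma>"
    then have "(\<Sum>i\<le>k. (\<gamma> i - w i)\<^sup>2 * (q i \<bullet> q i)) = 0"
      using val[OF o] square[of \<gamma>] by (simp add: opt)
    then show ?R unfolding excess_0 by (simp add: w_def)
  next
    assume ?R
    then have "\<And>i. i \<le> k \<Longrightarrow> \<gamma> i = w i" by (simp add: w_def)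
    moreover have "optimal_weights q \<delta> k w"
      unfolding opt using wd obj_w square excess_nonneg by auto
    ultimately show "optimal_weights q \<delta> k \<gamma>"
      using optimal_weights_cong by blast
  qed
qed

section \<open>Unnormalized Lanczos triples\<close>

locale lanczos =
  fixes H :: "real^'n^'n" and c :: "real^'n" and \<theta> :: "nat \<Rightarrow> real"
  assumes H_sym: "transpose H = H"
    and c_nz: "c \<noteq> 0"
    and theta_nz: "\<And>k. k < krylov_grade c H \<Longrightarrow> \<theta> k \<noteq> 0"
begin

abbreviation "q \<equiv> lanczos_q H c \<theta>"
abbreviation "y \<equiv> lanczos_y H c \<theta>"
abbreviation "\<delta> \<equiv> lanczos_delta H c \<theta>"
abbreviation "K \<equiv> krylov c H"
abbreviation "r \<equiv> krylov_grade c H"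
abbreviation "\<alpha> \<equiv> lanczos_alpha H c \<theta>"
abbreviation "\<beta> \<equiv> lanczos_beta H c \<theta>"

lemma inner_sym: "u \<bullet> (H *v v) = (H *v u) \<bullet> v"
  by (metis H_sym dot_lmul_matrix vector_transpose_matrix)

lemma q_1: "q (Suc 0) = \<theta> 0 *\<^sub>R (- (H *v q 0) + \<alpha> 0 *\<^sub>R q 0)"
  by (simp add: lanczos_alpha_def)

lemma q_Suc_Suc:
  "q (Suc (Suc k)) = \<theta> (Suc k) *\<^sub>R (- (H *v q (Suc k)) + \<alpha> (Suc k) *\<^sub>R q (Suc k) + \<beta> k *\<^sub>R q k)"
  by (simp add: lanczos_alpha_def lanczos_beta_def Let_def)

declare lanczos_q.simps(2,3) [simp del]

text \<open>The three recursions have the same coefficients; multiplying the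
  one for \<open>y\<close> by \<open>H\<close> and adding \<open>c\<close> times the one for \<open>\<delta>\<close> gives the one for \<open>q\<close>.\<close>

lemma q_eq: "q k = H *v y k + \<delta> k *\<^sub>R c"
proof (induction k rule: induct_nat_012)
  case (ge2 k)
  define a where "a = \<alpha> (Suc k)"
  define b where "b = \<beta> k"
  have "H *v y (Suc (Suc k)) + \<delta> (Suc (Suc k)) *\<^sub>R c
      = \<theta> (Suc k) *\<^sub>R (- (H *v q (Suc k)) + a *\<^sub>R (H *v y (Suc k) + \<delta> (Suc k) *\<^sub>R c)
          + b *\<^sub>R (H *v y k + \<delta> k *\<^sub>R c))"
    by (simp add: a_def b_def matrix_vector_right_distrib matrix_vector_mult_diff_distrib
        matrix_vector_mult_scaleR linear_neg[OF matrix_vector_mul_linear] algebra_simps)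
  also have "\<dots> = q (Suc (Suc k))"
    unfolding q_Suc_Suc ge2[symmetric] by (simp add: a_def b_def)
  finally show ?case by simp
qed (simp_all add: q_1 matrix_vector_mult_scaleR linear_neg[OF matrix_vector_mul_linear] algebra_simps)

lemma q_krylov: "q k \<in> K (Suc k)"
proof (induction k rule: induct_nat_012)
  case 0
  show ?case using krylov_start by simp
next
  case 1
  have "q 0 \<in> K (Suc (Suc 0))" "H *v q 0 \<in> K (Suc (Suc 0))"
    using krylov_start krylov_mult[OF krylov_start] by auto
  then show ?case
    unfolding q_1 by (intro subspace_mul subspace_add subspace_neg subspace_krylov)
next
  case (ge2 k)
  let ?K = "K (Suc (Suc (Suc k)))"
  have "H *v q (Suc k) \<in> ?K" "q (Suc k) \<in> ?K" "q k \<in> ?K"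
    using ge2 krylov_mult krylov_mono[of "Suc k" "Suc (Suc (Suc k))" c H]
      krylov_mono[of "Suc (Suc k)" "Suc (Suc (Suc k))" c H] by auto
  then show ?case
    unfolding q_Suc_Suc by (intro subspace_mul subspace_add subspace_neg subspace_krylov)
qed

lemma y_krylov: "y k \<in> K k"
proof (induction k rule: induct_nat_012)
  case 0
  show ?case using subspace_0[OF subspace_krylov] by simp
next
  case 1
  show ?case
    using q_krylov[of 0] by (auto intro!: subspace_mul subspace_neg subspace_krylov)
next
  case (ge2 k)
  let ?K = "K (Suc (Suc k))"
  have "q (Suc k) \<in> ?K" "y (Suc k) \<in> ?K" "y k \<in> ?K"
    using ge2 q_krylov[of "Suc k"] krylov_mono[of k "Suc (Suc k)" c H]
      krylov_mono[of "Suc k" "Suc (Suc k)" c H] by auto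
  then show ?case
    unfolding lanczos_y.simps by (intro subspace_mul subspace_add subspace_neg subspace_krylov)
qed

text \<open>A nonzero \<open>\<theta> k\<close> allows the recursions to be solved for \<open>H *v q k\<close> and for \<open>q k\<close>.\<close>

lemma H_q_span:
  assumes "k < r"
  shows "H *v q k \<in> span (q ` {..Suc k})"
proof (cases k)
  case 0
  have "H *v q 0 = \<alpha> 0 *\<^sub>R q 0 - (1 / \<theta> 0) *\<^sub>R q (Suc 0)"
    using theta_nz[OF assms] 0 unfolding q_1 by simp
  moreover have "q 0 \<in> span (q ` {..Suc 0})" "q (Suc 0) \<in> span (q ` {..Suc 0})"
    by (intro span_base imageI, simp)+
  ultimately show ?thesis
    unfolding 0 by (simp only: span_diff span_scale)
next
  case (Suc j)
  have "H *v q (Suc j) = \<alpha> (Suc j) *\<^sub>R q (Suc j) + \<beta> j *\<^sub>R q j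
      - (1 / \<theta> (Suc j)) *\<^sub>R q (Suc (Suc j))"
    using theta_nz[OF assms] Suc unfolding q_Suc_Suc by simp
  moreover have "q i \<in> span (q ` {..Suc (Suc j)})" if "i \<le> Suc (Suc j)" for i
    using that by (intro span_base imageI) simp
  ultimately show ?thesis
    unfolding Suc by (simp only: span_diff span_add span_scale le_SucI order_refl)
qed

lemma q_span_y:
  assumes "k < r"
  shows "q k \<in> span (y ` {..Suc k})"
proof (cases k)
  case 0
  have "q 0 = - (1 / \<theta> 0) *\<^sub>R y (Suc 0)"
    using theta_nz[OF assms] 0 by simp
  moreover have "y (Suc 0) \<in> span (y ` {..Suc 0})"
    by (intro span_base imageI) simp
  ultimately show ?thesis
    unfolding 0 by (simp only: span_scale)
next
  case (Suc j)
  have "q (Suc j) = \<alpha> (Suc j) *\<^sub>R y (Suc j) + \<beta> j *\<^sub>R y j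
      - (1 / \<theta> (Suc j)) *\<^sub>R y (Suc (Suc j))"
    using theta_nz[OF assms] Suc by simp
  moreover have "y i \<in> span (y ` {..Suc (Suc j)})" if "i \<le> Suc (Suc j)" for i
    using that by (intro span_base imageI) simp
  ultimately show ?thesis
    unfolding Suc by (simp only: span_diff span_add span_scale le_SucI order_refl)
qed

text \<open>By the recursion, \<open>H\<close> maps the span of \<open>q 0, \<dots>, q i\<close>
  into that of \<open>q 0, \<dots>, q (i + 1)\<close> while \<open>i < r\<close>, so the powers of \<open>H\<close> applied to \<open>c\<close> are reached
  one after another.\<close>

lemma krylov_eq_span_q:
  assumes "k \<le> Suc r"
  shows "K k = span (q ` {..<k})"
proof
  show "span (q ` {..<k}) \<subseteq> K k"
  proof (rule span_minimal[OF _ subspace_krylov], rule image_subsetI)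
    fix i assume "i \<in> {..<k}"
    then show "q i \<in> K k"
      using q_krylov[of i] krylov_mono[of "Suc i" k c H] by auto
  qed
  have power: "(((*v) H) ^^ i) c \<in> span (q ` {..i})" if "i < k" for i
    using that
  proof (induction i)
    case (Suc i)
    have "H *v ((((*v) H) ^^ i) c) \<in> span (q ` {..Suc i})"
    proof (rule linear_maps_span_into[of "(*v) H" "q ` {..i}"])
      show "linear ((*v) H)" by simp
      show "(((*v) H) ^^ i) c \<in> span (q ` {..i})"
        using Suc by simp
    next
      fix z assume "z \<in> q ` {..i}"
      then obtain j where j: "j \<le> i" "z = q j" by auto
      then have "H *v z \<in> span (q ` {..Suc j})"
        using H_q_span[of j] Suc.prems assms by simp
      moreover have "span (q ` {..Suc j}) \<subseteq> span (q ` {..Suc i})"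
        using j by (intro span_mono image_mono) auto
      ultimately show "H *v z \<in> span (q ` {..Suc i})" by blast
    qed
    then show ?case by simp
  qed (simp add: span_base)
  show "K k \<subseteq> span (q ` {..<k})"
    unfolding krylov_def
  proof (rule span_minimal[OF _ subspace_span], rule image_subsetI)
    fix i assume "i \<in> {..<k}"
    then have "(((*v) H) ^^ i) c \<in> span (q ` {..i})" "span (q ` {..i}) \<subseteq> span (q ` {..<k})"
      using power by (auto intro!: span_mono)
    then show "(((*v) H) ^^ i) c \<in> span (q ` {..<k})" by blast
  qed
qed

lemma krylov_eq_span_y:
  assumes "k \<le> r"
  shows "K k = span (y ` {..k})"
proof
  show "span (y ` {..k}) \<subseteq> K k"
  proof (rule span_minimal[OF _ subspace_krylov], rule image_subsetI)
    fix i assume "i \<in> {..k}"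
    then show "y i \<in> K k"
      using y_krylov[of i] krylov_mono[of i k c H] by auto
  qed
  have "span (q ` {..<k}) \<subseteq> span (y ` {..k})"
  proof (rule span_minimal[OF _ subspace_span], rule image_subsetI)
    fix i assume "i \<in> {..<k}"
    then have "q i \<in> span (y ` {..Suc i})" "span (y ` {..Suc i}) \<subseteq> span (y ` {..k})"
      using q_span_y[of i] assms by (auto intro!: span_mono)
    then show "q i \<in> span (y ` {..k})" by blast
  qed
  then show "K k \<subseteq> span (y ` {..k})"
    using krylov_eq_span_q[of k] assms by simp
qed

text \<open>The coefficients \<open>\<alpha>\<close> and \<open>\<beta>\<close> remove the components along the last two vectors. Along the
  earlier ones symmetry of \<open>H\<close> leaves nothing to remove, because \<open>H\<close> raises the index by at most
  one.  The argument also covers vectors \<open>q = 0\<close>, whose coefficients are zero.\<close>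

lemma q_orthogonal_less:
  assumes "i < k" and "k \<le> r"
  shows "q i \<bullet> q k = 0"
  using assms
proof (induction k arbitrary: i rule: less_induct)
  case (less k)
  have coeff: "lanczos_coeff H u v * (u \<bullet> u) = u \<bullet> (H *v v)" for u v
    by (cases "u = 0") (simp_all add: lanczos_coeff_def)
  show ?case
  proof (cases k)
    case 0
    then show ?thesis using less.prems by simp
  next
    case (Suc l)
    show ?thesis
    proof (cases l)
      case 0
      then have "i = 0" "k = Suc 0" using less.prems Suc by auto
      then show ?thesis
        using coeff[of "q 0" "q 0"] unfolding q_1
        by (simp add: q_1 lanczos_alpha_def inner_add_right inner_diff_right del: lanczos_q.simps)
    next
      case (Suc j)
      note k = \<open>k = Suc l\<close>[unfolded Suc]
      have IH: "q a \<bullet> q b = 0" if "a \<noteq> b" "a < k" "b < k" for a b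
        using less.IH[of a b] less.IH[of b a] less.prems that
        by (cases a b rule: linorder_cases) (auto simp: inner_commute)
      have exp: "q i \<bullet> q k = \<theta> (Suc j) * (- (q i \<bullet> (H *v q (Suc j)))
          + \<alpha> (Suc j) * (q i \<bullet> q (Suc j)) + \<beta> j * (q i \<bullet> q j))"
        unfolding k q_Suc_Suc by (simp add: inner_add_right inner_diff_right)
      consider "i = Suc j" | "i = j" | "i < j"
        using less.prems k by linarith
      then show ?thesis
      proof cases
        case 1
        then show ?thesis
          using coeff[of "q (Suc j)" "q (Suc j)"] IH[of "Suc j" j] k
          unfolding exp by (simp add: lanczos_alpha_def)
      next
        case 2
        then show ?thesis
          using coeff[of "q j" "q (Suc j)"] IH[of j "Suc j"] k
          unfolding exp by (simp add: lanczos_beta_def)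
      next
        case 3
        have "H *v q i \<in> span (q ` {..Suc i})"
          using H_q_span[of i] 3 k less.prems by simp
        then have "orthogonal (q (Suc j)) (H *v q i)"
        proof (rule orthogonal_to_span)
          fix x assume "x \<in> q ` {..Suc i}"
          then show "orthogonal (q (Suc j)) x"
            using 3 k IH[of "Suc j"] by (auto simp: orthogonal_def)
        qed
        then have "q i \<bullet> (H *v q (Suc j)) = 0"
          by (metis inner_commute inner_sym orthogonal_def)
        then show ?thesis
          using IH[of i "Suc j"] IH[of i j] 3 k unfolding exp by simp
      qed
    qed
  qed
qed

lemma q_orthogonal: "i \<noteq> k \<Longrightarrow> i \<le> r \<Longrightarrow> k \<le> r \<Longrightarrow> q i \<bullet> q k = 0"
  using q_orthogonal_less[of i k] q_orthogonal_less[of k i]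
  by (cases i k rule: linorder_cases) (auto simp: inner_commute)

text \<open>A zero among the spanning vectors would stop the growth of the spaces before \<open>r\<close>.\<close>

lemma q_nz:
  assumes "k < r"
  shows "q k \<noteq> 0"
proof
  assume "q k = 0"
  then have "K (Suc k) = K k"
    using krylov_eq_span_q[of k] krylov_eq_span_q[of "Suc k"] assms
    by (simp add: lessThan_Suc span_insert_0)
  then show False
    using krylov_below_grade[OF c_nz assms] by simp
qed

text \<open>The vector \<open>q r\<close> lies in the \<open>r\<close>-th space, because the spaces have stopped growing, and it is
  orthogonal to the vectors that span this space.\<close>

lemma q_r: "q r = 0"
proof -
  have "q r \<in> span (q ` {..<r})"
    using q_krylov[of r] krylov_grade_stable[of c H] krylov_eq_span_q[of r] by simp
  then have "orthogonal (q r) (q r)"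
    by (rule orthogonal_to_span) (use q_orthogonal[of r] in \<open>auto simp: orthogonal_def\<close>)
  then show ?thesis by (simp add: orthogonal_def)
qed

lemma y_r_nz: "y r \<noteq> 0"
proof
  obtain m where m: "r = Suc m"
    using krylov_grade_pos gr0_implies_Suc by blast
  assume "y r = 0"
  then have "K (Suc m) = K m"
    using krylov_eq_span_y[of m] krylov_eq_span_y[of "Suc m"] m
    by (simp add: atMost_Suc span_insert_0)
  then show False
    using krylov_below_grade[OF c_nz, of m H] m by simp
qed

section \<open>Minimum residual iterates\<close>

lemma residual_of_weights:
  assumes "(\<Sum>i\<le>k. \<gamma> i * \<delta> i) = 1"
  shows "H *v (\<Sum>i\<le>k. \<gamma> i *\<^sub>R y i) + c = (\<Sum>i\<le>k. \<gamma> i *\<^sub>R q i)"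
proof -
  have "(\<Sum>i\<le>k. \<gamma> i *\<^sub>R q i) = (\<Sum>i\<le>k. H *v (\<gamma> i *\<^sub>R y i) + (\<gamma> i * \<delta> i) *\<^sub>R c)"
    by (intro sum.cong refl, subst q_eq) (simp add: matrix_vector_mult_scaleR scaleR_add_right)
  also have "\<dots> = H *v (\<Sum>i\<le>k. \<gamma> i *\<^sub>R y i) + (\<Sum>i\<le>k. \<gamma> i * \<delta> i) *\<^sub>R c"
    by (simp add: sum.distrib scaleR_left.sum linear_sum[OF matrix_vector_mul_linear])
  finally show ?thesis using assms by simp
qed

lemma norm_sum_q:
  assumes "k \<le> r"
  shows "(norm (\<Sum>i\<le>k. \<gamma> i *\<^sub>R q i))\<^sup>2 = (\<Sum>i\<le>k. (\<gamma> i)\<^sup>2 * (q i \<bullet> q i))"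
proof -
  have "pairwise (\<lambda>i j. orthogonal (\<gamma> i *\<^sub>R q i) (\<gamma> j *\<^sub>R q j)) {..k}"
    using assms q_orthogonal by (auto simp: pairwise_def orthogonal_def)
  then show ?thesis
    by (subst norm_sum_Pythagorean) (simp_all add: power_mult_distrib power2_norm_eq_inner)
qed

text \<open>As \<open>y 0 = 0\<close> and \<open>\<delta> 0 = 1\<close>, the weight at \<open>0\<close> does not change the point but can be used to
  meet the constraint.\<close>

lemma krylov_weights:
  assumes "k \<le> r" and "x \<in> K k"
  shows "\<exists>\<gamma>. (\<Sum>i\<le>k. \<gamma> i * \<delta> i) = 1 \<and> x = (\<Sum>i\<le>k. \<gamma> i *\<^sub>R y i)"
proof -
  obtain \<gamma> where \<gamma>: "x = (\<Sum>i\<le>k. \<gamma> i *\<^sub>R y i)"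
    using span_image_atMost_sum[of x y k] krylov_eq_span_y assms by auto
  define \<gamma>' where "\<gamma>' = \<gamma>(0 := 1 - (\<Sum>i\<in>{..k} - {0}. \<gamma> i * \<delta> i))"
  have "(\<Sum>i\<le>k. \<gamma>' i * \<delta> i) = \<gamma>' 0 * \<delta> 0 + (\<Sum>i\<in>{..k} - {0}. \<gamma>' i * \<delta> i)"
    by (rule sum.remove) auto
  also have "(\<Sum>i\<in>{..k} - {0}. \<gamma>' i * \<delta> i) = (\<Sum>i\<in>{..k} - {0}. \<gamma> i * \<delta> i)"
    by (intro sum.cong) (auto simp: \<gamma>'_def)
  finally have "(\<Sum>i\<le>k. \<gamma>' i * \<delta> i) = 1"
    by (simp add: \<gamma>'_def)
  moreover have "(\<Sum>i\<le>k. \<gamma>' i *\<^sub>R y i) = x"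
    unfolding \<gamma> by (intro sum.cong) (auto simp: \<gamma>'_def)
  ultimately show ?thesis by metis
qed

lemma MR_solution_iff_weights:
  assumes "k \<le> r"
  shows "MR_solution H c k x \<longleftrightarrow>
    (\<exists>\<gamma>. optimal_weights q \<delta> k \<gamma> \<and> x = (\<Sum>i\<le>k. \<gamma> i *\<^sub>R y i))"
  unfolding MR_solution_def optimal_weights_def
proof (rule is_arg_min_reparametrize[where a = 2])
  fix \<gamma> :: "nat \<Rightarrow> real" assume \<gamma>: "(\<Sum>i\<le>k. \<gamma> i * \<delta> i) = 1"
  show "(\<Sum>i\<le>k. \<gamma> i *\<^sub>R y i) \<in> K k"
    unfolding krylov_eq_span_y[OF assms] by (intro span_sum span_scale span_base) auto
  show "(norm (H *v (\<Sum>i\<le>k. \<gamma> i *\<^sub>R y i) + c))\<^sup>2 = 2 * (1 / 2 * (\<Sum>i\<le>k. (\<gamma> i)\<^sup>2 * (q i \<bullet> q i)))"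
    using residual_of_weights[OF \<gamma>] norm_sum_q[OF assms] by simp
qed (use krylov_weights[OF assms] in auto)

text \<open>The normalizing sum \<open>S\<close> is positive because its term at \<open>0\<close> is \<open>1 / (c \<bullet> c)\<close>, and \<open>1 / S\<close> is the squared norm
  of the residual.\<close>

lemma
  assumes "k < r"
  shows MR_solution_below_grade: "MR_solution H c k x \<longleftrightarrow>
      x = (1 / (\<Sum>j\<le>k. (\<delta> j)\<^sup>2 / (q j \<bullet> q j))) *\<^sub>R (\<Sum>i\<le>k. (\<delta> i / (q i \<bullet> q i)) *\<^sub>R y i)"
    and MR_residual_nz: "MR_solution H c k x \<Longrightarrow> H *v x + c \<noteq> 0"
proof -
  define S where "S = (\<Sum>j\<le>k. (\<delta> j)\<^sup>2 / (q j \<bullet> q j))"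
  define w where "w i = 1 / S * (\<delta> i / (q i \<bullet> q i))" for i
  have "S > 0"
    unfolding S_def
  proof (rule sum_pos2[of _ 0])
    show "0 < (\<delta> 0)\<^sup>2 / (q 0 \<bullet> q 0)" using c_nz by simp
  qed auto
  have qk: "\<And>i. i \<le> k \<Longrightarrow> q i \<noteq> 0"
    using q_nz assms by simp
  have iff: "optimal_weights q \<delta> k \<gamma> \<longleftrightarrow> (\<forall>i\<le>k. \<gamma> i = w i)" for \<gamma>
    using optimal_weights_iff[of k q \<delta> \<gamma>] qk \<open>S > 0\<close> by (simp add: S_def w_def)
  have sum: "(\<Sum>i\<le>k. w i *\<^sub>R y i) = (1 / S) *\<^sub>R (\<Sum>i\<le>k. (\<delta> i / (q i \<bullet> q i)) *\<^sub>R y i)"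
    by (simp add: w_def scaleR_sum_right)
  have "MR_solution H c k x \<longleftrightarrow> (\<exists>\<gamma>. (\<forall>i\<le>k. \<gamma> i = w i) \<and> x = (\<Sum>i\<le>k. \<gamma> i *\<^sub>R y i))"
    using MR_solution_iff_weights[of k x] assms iff by simp
  also have "\<dots> \<longleftrightarrow> x = (\<Sum>i\<le>k. w i *\<^sub>R y i)"
    by (metis (no_types, lifting) atMost_iff sum.cong)
  finally show "MR_solution H c k x \<longleftrightarrow>
      x = (1 / (\<Sum>j\<le>k. (\<delta> j)\<^sup>2 / (q j \<bullet> q j))) *\<^sub>R (\<Sum>i\<le>k. (\<delta> i / (q i \<bullet> q i)) *\<^sub>R y i)"
    unfolding sum S_def .
  assume "MR_solution H c k x"
  then obtain \<gamma> where \<gamma>: "optimal_weights q \<delta> k \<gamma>" "x = (\<Sum>i\<le>k. \<gamma> i *\<^sub>R y i)"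
    using MR_solution_iff_weights[of k x] assms by auto
  then have "(\<Sum>i\<le>k. \<gamma> i * \<delta> i) = 1"
    by (simp add: optimal_weights_def is_arg_min_def)
  then have "(norm (H *v x + c))\<^sup>2 = (\<Sum>i\<le>k. (\<gamma> i)\<^sup>2 * (q i \<bullet> q i))"
    using residual_of_weights norm_sum_q[of k \<gamma>] assms \<gamma> by simp
  also have "\<dots> = 1 / S"
    using optimal_weights_value[of k q \<delta> \<gamma>] qk \<gamma> \<open>S > 0\<close> by (simp add: S_def)
  finally show "H *v x + c \<noteq> 0"
    using \<open>S > 0\<close> by auto
qed

text \<open>The residual \<open>0\<close> is attained, so a solution has residual \<open>0\<close>.  Orthogonality makes its weights
  vanish below \<open>r\<close>, and the constraint determines the last one.\<close>

lemma
  assumes "\<delta> r \<noteq> 0"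
  shows MR_solution_grade_consistent: "MR_solution H c r x \<longleftrightarrow> x = (1 / \<delta> r) *\<^sub>R y r"
    and MR_residual_grade_consistent: "MR_solution H c r x \<Longrightarrow> H *v x + c = 0"
proof -
  let ?x = "(1 / \<delta> r) *\<^sub>R y r"
  have mem: "?x \<in> K r"
    using y_krylov by (intro subspace_mul subspace_krylov)
  have "H *v y r = - (\<delta> r *\<^sub>R c)"
    using q_eq[of r] q_r by (simp add: eq_neg_iff_add_eq_0)
  then have res: "H *v ?x + c = 0"
    using assms by (simp add: matrix_vector_mult_scaleR)
  have MR: "MR_solution H c r z \<longleftrightarrow> z \<in> K r \<and> H *v z + c = 0" for z
  proof
    assume "MR_solution H c r z"
    then have "z \<in> K r" "\<not> (norm (H *v ?x + c))\<^sup>2 < (norm (H *v z + c))\<^sup>2"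
      using mem unfolding MR_solution_def is_arg_min_def by blast+
    then show "z \<in> K r \<and> H *v z + c = 0"
      unfolding res by simp
  qed (simp add: MR_solution_def is_arg_min_def)
  then show "MR_solution H c r x \<Longrightarrow> H *v x + c = 0" by simp
  show "MR_solution H c r x \<longleftrightarrow> x = ?x"
  proof
    assume "MR_solution H c r x"
    then have x: "x \<in> K r" "H *v x + c = 0" using MR by auto
    obtain \<gamma> where \<gamma>: "(\<Sum>i\<le>r. \<gamma> i * \<delta> i) = 1" "x = (\<Sum>i\<le>r. \<gamma> i *\<^sub>R y i)"
      using krylov_weights[OF order_refl x(1)] by blast
    have "(\<Sum>i\<le>r. (\<gamma> i)\<^sup>2 * (q i \<bullet> q i)) = 0"
      using x(2) residual_of_weights[OF \<gamma>(1)] norm_sum_q[of r \<gamma>] \<gamma>(2) by simp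
    then have "\<forall>i\<in>{..r}. (\<gamma> i)\<^sup>2 * (q i \<bullet> q i) = 0"
      by (subst (asm) sum_nonneg_eq_0_iff) auto
    then have \<gamma>0: "\<gamma> i = 0" if "i < r" for i
      using q_nz[OF that] that by fastforce
    have "(\<Sum>i\<le>r. \<gamma> i * \<delta> i) = \<gamma> r * \<delta> r" "(\<Sum>i\<le>r. \<gamma> i *\<^sub>R y i) = \<gamma> r *\<^sub>R y r"
      using \<gamma>0 by (auto simp: lessThan_Suc_atMost[symmetric])
    then show "x = ?x"
      using \<gamma> assms by (simp add: field_simps)
  qed (use MR mem res in auto)
qed

section \<open>The incompatible case\<close>

text \<open>Splitting a point along \<open>K r\<close> and its orthogonal complement splits its residual
  orthogonally, since \<open>K r\<close> contains \<open>c\<close> and \<open>H\<close> maps both parts into themselves.  Hence nothing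
  outside \<open>K r\<close> can lower the residual.\<close>

lemma MR_solution_imp_LS_solution:
  assumes "MR_solution H c r x"
  shows "LS_solution H c x"
proof -
  have inv: "H *v u \<in> K r" if "u \<in> K r" for u
    using krylov_mult[OF that] krylov_grade_stable[of c H] by simp
  have cK: "c \<in> K r"
    using krylov_start[of c H r] krylov_grade_stable[of c H] by simp
  have "(norm (H *v x + c))\<^sup>2 \<le> (norm (H *v z + c))\<^sup>2" for z
  proof -
    obtain u v where uv: "u \<in> span (K r)" "\<And>w. w \<in> span (K r) \<Longrightarrow> orthogonal v w" "z = u + v"
      using orthogonal_subspace_decomp_exists[of "K r" z] by blast
    then have u: "u \<in> K r" and v: "\<And>w. w \<in> K r \<Longrightarrow> v \<bullet> w = 0"
      by (simp_all only: span_eq_iff[THEN iffD2, OF subspace_krylov] orthogonal_def)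
    have "H *v u + c \<in> K r"
      using inv[OF u] cK subspace_krylov by (intro subspace_add)
    then have "orthogonal (H *v v) (H *v u + c)"
      using v inv by (simp add: orthogonal_def flip: inner_sym)
    then have "(norm (H *v v + (H *v u + c)))\<^sup>2 = (norm (H *v v))\<^sup>2 + (norm (H *v u + c))\<^sup>2"
      by (rule norm_add_Pythagorean)
    moreover have "H *v z + c = H *v v + (H *v u + c)"
      using uv(3) by (simp add: matrix_vector_right_distrib)
    moreover have "(norm (H *v x + c))\<^sup>2 \<le> (norm (H *v u + c))\<^sup>2"
      using assms u unfolding MR_solution_def is_arg_min_linorder by blast
    ultimately show ?thesis by (metis add_increasing zero_le_power2)
  qed
  then show ?thesis
    unfolding LS_solution_def is_arg_min_linorder by blast
qed

text \<open>For \<open>u\<close> in \<open>K r\<close>, the inner product with a kernel vector \<open>v\<close> depends on \<open>v\<close> only through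
  \<open>v \<bullet> c\<close>, because \<open>v \<bullet> q i = v \<bullet> (H *v y i + \<delta> i *\<^sub>R c) = \<delta> i * (v \<bullet> c)\<close>.  So the
  kernel meets \<open>K r\<close> in at most a line, and a point of \<open>K r\<close> orthogonal to a nonzero vector on it
  is orthogonal to the whole kernel.\<close>

lemma krylov_orthogonal_kernel:
  assumes "H *v v = 0" and "H *v w = 0" and "w \<in> K r" "w \<noteq> 0"
    and "u \<in> K r" and "w \<bullet> u = 0"
  shows "v \<bullet> u = 0"
proof -
  have ker: "v' \<bullet> q i = \<delta> i * (v' \<bullet> c)" if "H *v v' = 0" for v' i
    using that by (subst q_eq) (simp add: inner_add_right inner_sym)
  have orth: "p \<bullet> x = 0" if "\<And>i. p \<bullet> q i = 0" "x \<in> K r" for p x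
  proof -
    have "x \<in> span (q ` {..<r})"
      using that krylov_eq_span_q[of r] by simp
    then have "orthogonal p x"
      by (rule orthogonal_to_span) (use that in \<open>auto simp: orthogonal_def\<close>)
    then show ?thesis by (simp add: orthogonal_def)
  qed
  have "((w \<bullet> c) *\<^sub>R v - (v \<bullet> c) *\<^sub>R w) \<bullet> u = 0"
    by (rule orth) (use ker assms in \<open>auto simp: inner_diff_left\<close>)
  moreover have "w \<bullet> c \<noteq> 0"
    using orth[OF _ \<open>w \<in> K r\<close>, of w] ker[OF assms(2)] \<open>w \<noteq> 0\<close> by auto
  ultimately show ?thesis
    using \<open>w \<bullet> u = 0\<close> by (simp add: inner_diff_left)
qed

lemma H_y_r:
  assumes "\<delta> r = 0"
  shows "H *v y r = 0"
  using q_eq[of r] q_r assms by simp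

text \<open>The weight problems for \<open>r - 1\<close> and \<open>r\<close> coincide except that the last weight is arbitrary;
  the other weights describe the unique solution \<open>x'\<close> of step \<open>r - 1\<close>.\<close>

lemma MR_solution_grade_singular:
  assumes "\<delta> r = 0" and "MR_solution H c (r - 1) x'"
  shows "MR_solution H c r x \<longleftrightarrow> (\<exists>t. x = x' + t *\<^sub>R y r)"
proof -
  obtain m where m: "r = Suc m"
    using krylov_grade_pos gr0_implies_Suc by blast
  have opt: "optimal_weights q \<delta> r \<gamma> \<longleftrightarrow> optimal_weights q \<delta> m \<gamma>" for \<gamma>
    unfolding m by (rule optimal_weights_free_last) (use q_r assms m in auto)
  have sum_r: "(\<Sum>i\<le>r. \<gamma> i *\<^sub>R y i) = (\<Sum>i\<le>m. \<gamma> i *\<^sub>R y i) + \<gamma> r *\<^sub>R y r" for \<gamma> :: "nat \<Rightarrow> real"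
    by (simp add: m)
  have iff_r: "MR_solution H c r z \<longleftrightarrow>
      (\<exists>\<gamma>. optimal_weights q \<delta> m \<gamma> \<and> z = (\<Sum>i\<le>m. \<gamma> i *\<^sub>R y i) + \<gamma> r *\<^sub>R y r)" for z
    using MR_solution_iff_weights[of r z] by (simp only: opt sum_r order_refl)
  have iff_m: "MR_solution H c m z \<longleftrightarrow>
      (\<exists>\<gamma>. optimal_weights q \<delta> m \<gamma> \<and> z = (\<Sum>i\<le>m. \<gamma> i *\<^sub>R y i))" for z
    using MR_solution_iff_weights[of m z] m by simp
  have x': "MR_solution H c m x'"
    using assms m by simp
  show ?thesis
  proof
    assume "MR_solution H c r x"
    then obtain \<gamma> where \<gamma>: "optimal_weights q \<delta> m \<gamma>"
        "x = (\<Sum>i\<le>m. \<gamma> i *\<^sub>R y i) + \<gamma> r *\<^sub>R y r"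
      using iff_r by blast
    then have "MR_solution H c m (\<Sum>i\<le>m. \<gamma> i *\<^sub>R y i)"
      using iff_m by blast
    then have "(\<Sum>i\<le>m. \<gamma> i *\<^sub>R y i) = x'"
      using x' MR_solution_below_grade[of m] m by simp
    then show "\<exists>t. x = x' + t *\<^sub>R y r"
      using \<gamma> by blast
  next
    assume "\<exists>t. x = x' + t *\<^sub>R y r"
    then obtain t where t: "x = x' + t *\<^sub>R y r" by blast
    obtain \<gamma> where \<gamma>: "optimal_weights q \<delta> m \<gamma>" "x' = (\<Sum>i\<le>m. \<gamma> i *\<^sub>R y i)"
      using iff_m x' by blast
    have "optimal_weights q \<delta> m (\<gamma>(r := t))"
      using \<gamma>(1) by (subst optimal_weights_cong[of m _ \<gamma>]) (auto simp: m)
    moreover have "x = (\<Sum>i\<le>m. (\<gamma>(r := t)) i *\<^sub>R y i) + (\<gamma>(r := t)) r *\<^sub>R y r"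
      unfolding t \<gamma>(2) by (auto simp: m intro!: sum.cong)
    ultimately show "MR_solution H c r x"
      using iff_r by blast
  qed
qed

text \<open>Any other minimizer is \<open>x\<close> plus a kernel vector, which is orthogonal to \<open>x\<close>.\<close>

lemma LS_minimum_norm:
  assumes "MR_solution H c r x" and "\<delta> r = 0" and "y r \<bullet> x = 0"
  shows "is_arg_min norm (LS_solution H c) x"
  unfolding is_arg_min_linorder
proof (intro conjI allI impI)
  show LS: "LS_solution H c x"
    using assms(1) by (rule MR_solution_imp_LS_solution)
  fix z assume z: "LS_solution H c z"
  have "H *v (z - x) = 0"
    using LS_solution_diff_kernel[OF z LS] .
  moreover have "x \<in> K r"
    using assms(1) by (simp add: MR_solution_def is_arg_min_def)
  ultimately have "(z - x) \<bullet> x = 0"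
    using krylov_orthogonal_kernel H_y_r y_krylov y_r_nz assms by blast
  then have "(norm ((z - x) + x))\<^sup>2 = (norm (z - x))\<^sup>2 + (norm x)\<^sup>2"
    by (intro norm_add_Pythagorean) (simp add: orthogonal_def)
  then have "(norm x)\<^sup>2 \<le> (norm z)\<^sup>2" by simp
  then show "norm x \<le> norm z" by simp
qed

end

theorem theorem4p1:
  fixes H :: "real^'n^'n" and c :: "real^'n" and \<theta> :: "nat \<Rightarrow> real"
    and q y :: "nat \<Rightarrow> real^'n" and \<delta> :: "nat \<Rightarrow> real" and r :: nat
  assumes H_sym: "transpose H = H"
    and c_nz: "c \<noteq> 0"
    and r_eq: "r = krylov_grade c H"
    and theta_nz: "\<forall>k<r. \<theta> k \<noteq> 0"
    and q_eq: "q = lanczos_q H c \<theta>"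
    and y_eq: "y = lanczos_y H c \<theta>"
    and delta_eq: "\<delta> = lanczos_delta H c \<theta>"
  shows
    "(\<forall>k\<le>r. \<forall>x. MR_solution H c k x \<longleftrightarrow>
        (\<exists>\<gamma>. optimal_weights q \<delta> k \<gamma> \<and> x = (\<Sum>i\<le>k. \<gamma> i *\<^sub>R y i)))
   \<and> (\<forall>k<r. \<forall>x.
        (MR_solution H c k x \<longleftrightarrow>
          x = (1 / (\<Sum>j\<le>k. (\<delta> j)\<^sup>2 / (q j \<bullet> q j))) *\<^sub>R (\<Sum>i\<le>k. (\<delta> i / (q i \<bullet> q i)) *\<^sub>R y i))
        \<and> (MR_solution H c k x \<longrightarrow> H *v x + c \<noteq> 0))
   \<and> (\<delta> r \<noteq> 0 \<longrightarrow>
        (\<forall>x. (MR_solution H c r x \<longleftrightarrow> x = (1 / \<delta> r) *\<^sub>R y r)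
           \<and> (MR_solution H c r x \<longrightarrow> H *v x + c = 0)))
   \<and> (\<delta> r = 0 \<longrightarrow>
        (\<forall>x'. MR_solution H c (r - 1) x' \<longrightarrow>
           (\<forall>x. MR_solution H c r x \<longleftrightarrow> (\<exists>\<gamma>r. x = x' + \<gamma>r *\<^sub>R y r))
         \<and> (\<forall>x. MR_solution H c r x \<longrightarrow> H *v x + c = H *v x' + c \<and> H *v x + c \<noteq> 0 \<and> LS_solution H c x)
         \<and> LS_solution H c x'
         \<and> is_arg_min norm (LS_solution H c) (x' + (- (y r \<bullet> x') / (y r \<bullet> y r)) *\<^sub>R y r)))"
proof -
  interpret L: lanczos H c \<theta>
    using H_sym c_nz theta_nz r_eq by unfold_locales auto
  show ?thesis
    unfolding r_eq q_eq y_eq delta_eq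
  proof (intro conjI impI allI)
    let ?r = "krylov_grade c H"
    let ?yr = "lanczos_y H c \<theta> ?r"
    fix x' assume \<delta>: "lanczos_delta H c \<theta> ?r = 0" and x': "MR_solution H c (?r - 1) x'"
    note iff = L.MR_solution_grade_singular[OF \<delta> x']
    show "MR_solution H c ?r x \<longleftrightarrow> (\<exists>\<gamma>r. x = x' + \<gamma>r *\<^sub>R ?yr)" for x
      by (rule iff)
    have x'_r: "MR_solution H c ?r x'"
      unfolding iff by (intro exI[of _ 0]) simp
    show "LS_solution H c x'"
      by (rule L.MR_solution_imp_LS_solution[OF x'_r])
    show "LS_solution H c x" if "MR_solution H c ?r x" for x
      by (rule L.MR_solution_imp_LS_solution[OF that])
    show res: "H *v x + c = H *v x' + c" if "MR_solution H c ?r x" for x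
      using that unfolding iff
      by (auto simp: matrix_vector_right_distrib matrix_vector_mult_scaleR L.H_y_r[OF \<delta>])
    show "H *v x + c \<noteq> 0" if "MR_solution H c ?r x" for x
      using res[OF that] L.MR_residual_nz[OF _ x'] krylov_grade_pos[of c H] by simp
    show "is_arg_min norm (LS_solution H c) (x' + (- (?yr \<bullet> x') / (?yr \<bullet> ?yr)) *\<^sub>R ?yr)"
    proof (rule L.LS_minimum_norm[OF _ \<delta>])
      show "MR_solution H c ?r (x' + (- (?yr \<bullet> x') / (?yr \<bullet> ?yr)) *\<^sub>R ?yr)"
        unfolding iff by blast
      show "?yr \<bullet> (x' + (- (?yr \<bullet> x') / (?yr \<bullet> ?yr)) *\<^sub>R ?yr) = 0"
        using L.y_r_nz by (simp add: inner_add_right inner_diff_right)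
    qed
  next
    fix k x assume k: "k < krylov_grade c H"
    show "MR_solution H c k x \<longleftrightarrow> x = (1 / (\<Sum>j\<le>k. (lanczos_delta H c \<theta> j)\<^sup>2
        / (lanczos_q H c \<theta> j \<bullet> lanczos_q H c \<theta> j))) *\<^sub>R
      (\<Sum>i\<le>k. (lanczos_delta H c \<theta> i / (lanczos_q H c \<theta> i \<bullet> lanczos_q H c \<theta> i))
        *\<^sub>R lanczos_y H c \<theta> i)"
      by (rule L.MR_solution_below_grade[OF k])
    show "H *v x + c \<noteq> 0" if "MR_solution H c k x"
      by (rule L.MR_residual_nz[OF k that])
  qed (fact L.MR_solution_iff_weights L.MR_solution_grade_consistent L.MR_residual_grade_consistent)+
qed

end
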